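(* Consider the $n$-person affine-quadratic dynamic game described in the context, with open-loop information pattern. For $i\in N$ define backward in $k$ ($M_k^i,m_k^i$ for $k=T,\dots,0$ and $\Phi_k,\phi_k$ for $k=T-1,\dots,0$) $$\Phi_k=\Big(I+\sum_{j\in N}B_{k+1}^j(R_{k+1}^{jj})^{-1}B_{k+1}^{j'}M_{k+1}^j\Big)^{-1}A_{k+1},$$ $$\phi_k=\Big(I+\sum_{j\in N}B_{k+1}^j(R_{k+1}^{jj})^{-1}B_{k+1}^{j'}M_{k+1}^j\Big)^{-1}\Big(s_{k+1}-\sum_{j\in N}B_{k+1}^j\big((R_{k+1}^{jj})^{-1}B_{k+1}^{j'}(m_{k+1}^j-Q_{k+1}^j\tilde x_{k+1}^j)-\tilde u_{k+1}^{jj}\big)\Big),$$ $$M_k^i=Q_k^i+A_{k+1}'M_{k+1}^i\Phi_k,\qquad M_T^i=Q_T^i,$$ $$m_k^i=A_{k+1}'\big[M_{k+1}^i\phi_k+m_{k+1}^i-Q_{k+1}^i\tilde x_{k+1}^i\big],\qquad m_T^i=0.$$ Assume that $Q_k^i\ge0$ and $R_k^{ii}>0$ for all $k\in K$, $i\in N$, and that $\big(I+\sum_{j\in N}B_k^j(R_k^{jj})^{-1}B_k^{j'}M_k^j\big)^{-1}$ exists for all $k\in K$. Then the game admits a unique open-loop Nash equilibrium solution. The unique equilibrium strategies are, for $k\in\{0,\dots,T-1\}$ and $i\in N$, $$\gamma_{k+1}^{i*}(x_0)=u_{k+1}^{i*}=-P_{k+1}^{i*}x_k^*-\alpha_{k+1}^{i*},$$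 $$P_{k+1}^{i*}=(R_{k+1}^{ii})^{-1}B_{k+1}^{i'}M_{k+1}^i\Phi_k,\qquad \alpha_{k+1}^{i*}=(R_{k+1}^{ii})^{-1}B_{k+1}^{i'}(M_{k+1}^i\phi_k+m_{k+1}^i-Q_{k+1}^i\tilde x_{k+1}^i)-\tilde u_{k+1}^{ii},$$ where the associated state trajectory is $x_{k+1}^*=\Phi_kx_k^*+\phi_k$, $x_0^*=x_0$.
   Context: A prime denotes transpose; for symmetric matrices $>0$ means positive definite and $\ge0$ positive semidefinite. Affine-quadratic game: players $N=\{1,\dots,n\}$, stages $K=\{1,\dots,T\}$, states $x_k\in\mathbb R^p$, controls $u_k^i\in\mathbb R^{m_i}$, dynamics $x_k=A_kx_{k-1}+\sum_{j\in N}B_k^ju_k^j+s_k$ with $x_0$ given. Player $i$ minimizes $L^i=\sum_{k=1}^Tg_k^i(x_k,u_k^1,\dots,u_k^n,x_{k-1})$ with $$g_k^i=\tfrac12\Big(x_k'Q_k^ix_k+\sum_{j\in N}u_k^{j'}R_k^{ij}u_k^j\Big)+\tfrac12\Big(\tilde x_k^{i'}Q_k^i\tilde x_k^i+\sum_{j\in N}\tilde u_k^{ij'}R_k^{ij}\tilde u_k^{ij}\Big)-\tilde x_k^{i'}Q_k^ix_k-\sum_{j\in N}\tilde u_k^{ij'}R_k^{ij}u_k^j .$$ The $A_k,B_k^i,Q_k^i,R_k^{ij},s_k,\tilde x_k^i,\tilde u_k^{ij}$ are given matrices/vectors of appropriate dimensions, with $Q_k^i,R_k^{ij}$ symmetric.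 Convention: $Q_0^i:=0$. Open-loop information pattern: players know only $x_0$, so (for given $x_0$) a strategy of player $i$ is a control sequence $u^i=(u_1^i,\dots,u_T^i)$. An open-loop Nash equilibrium is a tuple $(u^{1*},\dots,u^{n*})$ such that for each $i$, $L^i(x_0,u^{1*},\dots,u^{n*})\le L^i(x_0,u^{1*},\dots,u^i,\dots,u^{n*})$ for all control sequences $u^i$ of player $i$. *)

theory Defs
  imports Complex_Main "HOL-Library.FuncSet" "Jordan_Normal_Form.Gauss_Jordan_Elimination"
begin

text \<open>Control dimensions differ between players, so vectors and matrices carry their dimension as
  a value instead of having it fixed by their type.\<close>

definition minv :: "real mat \<Rightarrow> real mat" where
  "minv A = the (mat_inverse A)"

definition pos_semidef :: "real mat \<Rightarrow> bool" where
  "pos_semidef A \<longleftrightarrow> square_mat A \<and> transpose_mat A = A \<and>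
     (\<forall>v\<in>carrier_vec (dim_row A). v \<bullet> (A *\<^sub>v v) \<ge> 0)"

definition pos_def :: "real mat \<Rightarrow> bool" where
  "pos_def A \<longleftrightarrow> square_mat A \<and> transpose_mat A = A \<and>
     (\<forall>v\<in>carrier_vec (dim_row A). v \<noteq> 0\<^sub>v (dim_row A) \<longrightarrow> v \<bullet> (A *\<^sub>v v) > 0)"

text \<open>The stage index comes first in all stage-dependent data: \<open>Rmat G k i j\<close> is $R_k^{ij}$,
  \<open>xtgt G k i\<close> is $\tilde x_k^i$ and \<open>utgt G k i j\<close> is $\tilde u_k^{ij}$.\<close>

record aq_game =
  nplayers :: nat
  horizon :: nat
  sdim :: nat
  cdim :: "nat \<Rightarrow> nat"
  Amat :: "nat \<Rightarrow> real mat"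
  Bmat :: "nat \<Rightarrow> nat \<Rightarrow> real mat"
  svec :: "nat \<Rightarrow> real vec"
  Qmat :: "nat \<Rightarrow> nat \<Rightarrow> real mat"
  Rmat :: "nat \<Rightarrow> nat \<Rightarrow> nat \<Rightarrow> real mat"
  xtgt :: "nat \<Rightarrow> nat \<Rightarrow> real vec"
  utgt :: "nat \<Rightarrow> nat \<Rightarrow> nat \<Rightarrow> real vec"

definition players :: "aq_game \<Rightarrow> nat set" where
  "players G = {1..nplayers G}"

definition stages :: "aq_game \<Rightarrow> nat set" where
  "stages G = {1..horizon G}"

definition wf_game :: "aq_game \<Rightarrow> bool" where
  "wf_game G \<longleftrightarrow>
     (\<forall>k\<in>stages G.
        Amat G k \<in> carrier_mat (sdim G) (sdim G) \<and>
        svec G k \<in> carrier_vec (sdim G) \<and>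
        (\<forall>i\<in>players G.
           Bmat G k i \<in> carrier_mat (sdim G) (cdim G i) \<and>
           Qmat G k i \<in> carrier_mat (sdim G) (sdim G) \<and>
           transpose_mat (Qmat G k i) = Qmat G k i \<and>
           xtgt G k i \<in> carrier_vec (sdim G) \<and>
           (\<forall>j\<in>players G.
              Rmat G k i j \<in> carrier_mat (cdim G j) (cdim G j) \<and>
              transpose_mat (Rmat G k i j) = Rmat G k i j \<and>
              utgt G k i j \<in> carrier_vec (cdim G j))))"

text \<open>A profile \<open>u\<close> assigns to player \<open>i\<close> and stage \<open>k\<close> the control \<open>u i k\<close>. Profiles are
  extensional functions, so that equality of profiles means equality on all players and stages.\<close>

definition strategies :: "aq_game \<Rightarrow> nat \<Rightarrow> (nat \<Rightarrow> real vec) set" where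
  "strategies G i = (\<Pi>\<^sub>E k\<in>stages G. carrier_vec (cdim G i))"

definition profiles :: "aq_game \<Rightarrow> (nat \<Rightarrow> nat \<Rightarrow> real vec) set" where
  "profiles G = (\<Pi>\<^sub>E i\<in>players G. strategies G i)"

fun state :: "aq_game \<Rightarrow> real vec \<Rightarrow> (nat \<Rightarrow> nat \<Rightarrow> real vec) \<Rightarrow> nat \<Rightarrow> real vec" where
  "state G x0 u 0 = x0"
| "state G x0 u (Suc k) =
     Amat G (Suc k) *\<^sub>v state G x0 u k
     + finsum_vec TYPE(real) (sdim G) (\<lambda>j. Bmat G (Suc k) j *\<^sub>v u j (Suc k)) (players G)
     + svec G (Suc k)"

definition stage_cost :: "aq_game \<Rightarrow> nat \<Rightarrow> nat \<Rightarrow> real vec \<Rightarrow> (nat \<Rightarrow> real vec) \<Rightarrow> real" where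
  "stage_cost G i k x w =
     1/2 * (x \<bullet> (Qmat G k i *\<^sub>v x) + (\<Sum>j\<in>players G. w j \<bullet> (Rmat G k i j *\<^sub>v w j)))
     + 1/2 * (xtgt G k i \<bullet> (Qmat G k i *\<^sub>v xtgt G k i)
              + (\<Sum>j\<in>players G. utgt G k i j \<bullet> (Rmat G k i j *\<^sub>v utgt G k i j)))
     - xtgt G k i \<bullet> (Qmat G k i *\<^sub>v x)
     - (\<Sum>j\<in>players G. utgt G k i j \<bullet> (Rmat G k i j *\<^sub>v w j))"

definition total_cost :: "aq_game \<Rightarrow> real vec \<Rightarrow> nat \<Rightarrow> (nat \<Rightarrow> nat \<Rightarrow> real vec) \<Rightarrow> real" where
  "total_cost G x0 i u = (\<Sum>k\<in>stages G. stage_cost G i k (state G x0 u k) (\<lambda>j. u j k))"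

definition open_loop_nash :: "aq_game \<Rightarrow> real vec \<Rightarrow> (nat \<Rightarrow> nat \<Rightarrow> real vec) \<Rightarrow> bool" where
  "open_loop_nash G x0 u \<longleftrightarrow> u \<in> profiles G \<and>
     (\<forall>i\<in>players G. \<forall>v\<in>strategies G i. total_cost G x0 i u \<le> total_cost G x0 i (u(i := v)))"

definition Qext :: "aq_game \<Rightarrow> nat \<Rightarrow> nat \<Rightarrow> real mat" where
  "Qext G k i = (if k = 0 then 0\<^sub>m (sdim G) (sdim G) else Qmat G k i)"

text \<open>\<open>coupling G k Mk\<close> is $I + \sum_{j\in N} B_k^j (R_k^{jj})^{-1} B_k^{j\prime} M_k^j$.\<close>

definition coupling :: "aq_game \<Rightarrow> nat \<Rightarrow> (nat \<Rightarrow> real mat) \<Rightarrow> real mat" where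
  "coupling G k Mk = 1\<^sub>m (sdim G) +
     finsum (ring_mat TYPE(real) (sdim G) ())
       (\<lambda>j. Bmat G k j * minv (Rmat G k j j) * transpose_mat (Bmat G k j) * Mk j) (players G)"

text \<open>The values of \<open>Phi G k\<close> and \<open>phi G k\<close> for \<open>k \<ge> horizon G\<close> are placeholders that make the
  backward recursions total.\<close>

function Mric :: "aq_game \<Rightarrow> nat \<Rightarrow> nat \<Rightarrow> real mat"
  and Phi :: "aq_game \<Rightarrow> nat \<Rightarrow> real mat" where
  "Mric G k i =
     (if k < horizon G
      then Qext G k i + transpose_mat (Amat G (Suc k)) * Mric G (Suc k) i * Phi G k
      else Qext G (horizon G) i)"
| "Phi G k =
     (if k < horizon G
      then minv (coupling G (Suc k) (\<lambda>j. Mric G (Suc k) j)) * Amat G (Suc k)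
      else undefined)"
  by pat_completeness auto
termination
  by (relation "measure (\<lambda>a. case a of Inl (G, k, i) \<Rightarrow> 2 * (horizon G - k) + 1
                                     | Inr (G, k) \<Rightarrow> 2 * (horizon G - k))") auto

function mric :: "aq_game \<Rightarrow> nat \<Rightarrow> nat \<Rightarrow> real vec"
  and phi :: "aq_game \<Rightarrow> nat \<Rightarrow> real vec" where
  "mric G k i =
     (if k < horizon G
      then transpose_mat (Amat G (Suc k)) *\<^sub>v
             (Mric G (Suc k) i *\<^sub>v phi G k + mric G (Suc k) i
              - Qmat G (Suc k) i *\<^sub>v xtgt G (Suc k) i)
      else 0\<^sub>v (sdim G))"
| "phi G k =
     (if k < horizon G
      then minv (coupling G (Suc k) (\<lambda>j. Mric G (Suc k) j)) *\<^sub>v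
             (svec G (Suc k)
              - finsum_vec TYPE(real) (sdim G)
                  (\<lambda>j. Bmat G (Suc k) j *\<^sub>v
                     (minv (Rmat G (Suc k) j j) *\<^sub>v
                        (transpose_mat (Bmat G (Suc k) j) *\<^sub>v
                           (mric G (Suc k) j - Qmat G (Suc k) j *\<^sub>v xtgt G (Suc k) j))
                      - utgt G (Suc k) j j))
                  (players G))
      else undefined)"
  by pat_completeness auto
termination
  by (relation "measure (\<lambda>a. case a of Inl (G, k, i) \<Rightarrow> 2 * (horizon G - k) + 1
                                     | Inr (G, k) \<Rightarrow> 2 * (horizon G - k))") auto

declare Mric.simps [simp del] Phi.simps [simp del] mric.simps [simp del] phi.simps [simp del]

text \<open>\<open>Pgain G k i\<close> and \<open>alph G k i\<close> are $P_k^{i*}$ and $\alpha_k^{i*}$, meant for $k \ge 1$.\<close>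

definition Pgain :: "aq_game \<Rightarrow> nat \<Rightarrow> nat \<Rightarrow> real mat" where
  "Pgain G k i =
     minv (Rmat G k i i) * transpose_mat (Bmat G k i) * Mric G k i * Phi G (k - 1)"

definition alph :: "aq_game \<Rightarrow> nat \<Rightarrow> nat \<Rightarrow> real vec" where
  "alph G k i =
     (minv (Rmat G k i i) * transpose_mat (Bmat G k i)) *\<^sub>v
       (Mric G k i *\<^sub>v phi G (k - 1) + mric G k i - Qmat G k i *\<^sub>v xtgt G k i)
     - utgt G k i i"

fun xstar :: "aq_game \<Rightarrow> real vec \<Rightarrow> nat \<Rightarrow> real vec" where
  "xstar G x0 0 = x0"
| "xstar G x0 (Suc k) = Phi G k *\<^sub>v xstar G x0 k + phi G k"

end

theory Submission
  imports Defs "Jordan_Normal_Form.Determinant"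
begin

text \<open>A player's cost is a convex quadratic function of her own controls, so it equals its first-order
  expansion plus a nonnegative quadratic form. Hence a profile is an equilibrium iff all gradients
  vanish. The gradients are expressed through costates, which satisfy a linear backward recursion.
  By backward induction the costate of player \<open>i\<close> is $M_k^i x_k + m_k^i - Q_k^i \tilde x_k^i$ along
  every trajectory of an equilibrium; inserting this into the dynamics gives a linear equation for
  $x_{k+1}$ whose matrix is the coupling matrix, hence $x_{k+1} = \Phi_k x_k + \phi_k$. Conversely, the
  controls determined by $x^*$ have vanishing gradients.\<close>

text \<open>States run forward from \<open>x0\<close> while costates run backward from the horizon,
  so neither can be computed first. The obstacle is resolved because stationarity at stage k+1
  expresses every control through x_{k+1} and the costate at k+1 only, and the backward hypothesis
  has already made that costate an affine function of x_{k+1}; the dynamics then become an implicit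
  equation in x_{k+1} with x_k as a parameter.

  Uniqueness comes from this elimination. Strict convexity of each cost in the player's own controls
  would only make best responses unique, whereas an equilibrium is a simultaneous solution for all
  players. What decides is the coupling matrix, which adds up the reactions of all players to one
  state. For the same reason the matrices M_k^i are in general not symmetric (\<open>Phi\<close>
  mixes the players), and convexity is read off Q and R directly rather than off M.\<close>

section \<open>Linear algebra with explicit dimensions\<close>

lemma scalar_prod_self_eq_0:
  fixes g :: "real vec"
  assumes "g \<in> carrier_vec n" "g \<bullet> g = 0"
  shows "g = 0\<^sub>v n"
proof -
  have "\<forall>i\<in>{0..<dim_vec g}. g $ i * g $ i = 0"
    using assms(2) unfolding scalar_prod_def
    by (subst (asm) sum_nonneg_eq_0_iff) auto
  then show ?thesis
    using assms(1) by (intro eq_vecI) auto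
qed

lemma zero_mult_mat_vec:
  "(v :: real vec) \<in> carrier_vec m \<Longrightarrow> 0\<^sub>m n m *\<^sub>v v = 0\<^sub>v n"
  by (intro eq_vecI) auto

lemma scalar_prod_self_ge_0: "(g :: real vec) \<bullet> g \<ge> 0"
  unfolding scalar_prod_def by (intro sum_nonneg) auto

text \<open>\<open>invertible_mat\<close> provides an inverse without dimensions; these are read off
  the column counts of the two identity products. Membership in \<open>Units\<close> then rules out
  the result \<open>None\<close> of \<open>mat_inverse\<close>, so that \<open>the\<close> in
  \<open>minv\<close> is meaningful.\<close>

lemma minv_inverse:
  fixes A :: "real mat"
  assumes "A \<in> carrier_mat n n" "invertible_mat A"
  shows "minv A \<in> carrier_mat n n" "A * minv A = 1\<^sub>m n" "minv A * A = 1\<^sub>m n"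
proof -
  obtain B where B: "inverts_mat A B" "inverts_mat B A"
    using assms(2) unfolding invertible_mat_def by auto
  have "dim_row B = n" "dim_col B = n"
    using B assms(1) unfolding inverts_mat_def
    by (metis carrier_matD(2) index_mult_mat(3) index_one_mat(3))
      (metis B(1) assms(1) carrier_matD(1) index_mult_mat(3) index_one_mat(3) inverts_mat_def)
  then have "A \<in> Units (ring_mat TYPE(real) n ())"
    using B assms(1) unfolding Units_def ring_mat_def inverts_mat_def by auto
  with mat_inverse(1)[OF assms(1), of "()"] obtain C where "mat_inverse A = Some C"
    by (cases "mat_inverse A") auto
  with mat_inverse(2)[OF assms(1) this]
  show "minv A \<in> carrier_mat n n" "A * minv A = 1\<^sub>m n" "minv A * A = 1\<^sub>m n"
    unfolding minv_def by auto
qed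

lemma pos_def_invertible:
  assumes "A \<in> carrier_mat n n" "pos_def A"
  shows "invertible_mat A"
proof -
  have "det A \<noteq> 0"
  proof
    assume "det A = 0"
    then obtain v where v: "v \<in> carrier_vec n" "v \<noteq> 0\<^sub>v n" "A *\<^sub>v v = 0\<^sub>v n"
      using det_0_iff_vec_prod_zero_field[OF assms(1)] by auto
    then have "v \<bullet> (A *\<^sub>v v) > 0"
      using assms unfolding pos_def_def by auto
    then show False
      using v by simp
  qed
  from det_non_zero_imp_unit[OF assms(1) this, of "()"]
  obtain B where "B \<in> carrier_mat n n" "A * B = 1\<^sub>m n" "B * A = 1\<^sub>m n"
    unfolding Units_def ring_mat_def by auto
  then show ?thesis
    using assms unfolding invertible_mat_def inverts_mat_def square_mat.simps
    by (intro conjI exI[of _ B]) auto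
qed

text \<open>Serves two purposes: with R_k^{ii} it solves stationarity for the control, and with the
  coupling matrix it solves the implicit equation for the next state.\<close>

lemma minv_solve:
  fixes A :: "real mat"
  assumes "A \<in> carrier_mat n n" "invertible_mat A" "x \<in> carrier_vec n" "b \<in> carrier_vec n"
  shows "A *\<^sub>v x = b \<longleftrightarrow> x = minv A *\<^sub>v b"
  using minv_inverse[OF assms(1,2)] assms
  by (metis assoc_mult_mat_vec one_mult_mat_vec)

text \<open>Links the two kinds of sum in the definitions: \<open>coupling\<close> adds matrices in
  the abstract ring \<open>ring_mat\<close>, while the dynamics add vectors with
  \<open>finsum_vec\<close>.\<close>

lemma finsum_ring_mat_mult_vec:
  fixes X :: "'a \<Rightarrow> real mat"
  assumes "finite F" "X \<in> F \<rightarrow> carrier_mat n n" "v \<in> carrier_vec n"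
  shows "finsum (ring_mat TYPE(real) n ()) X F \<in> carrier_mat n n"
    and "finsum (ring_mat TYPE(real) n ()) X F *\<^sub>v v = finsum_vec TYPE(real) n (\<lambda>j. X j *\<^sub>v v) F"
proof -
  interpret R: ring "ring_mat TYPE(real) n ()"
    by (rule ring_mat)
  have closed: "finsum (ring_mat TYPE(real) n ()) X F' \<in> carrier_mat n n"
    if "X \<in> F' \<rightarrow> carrier_mat n n" for F'
    using R.finsum_closed[of X F'] that by (simp add: ring_mat_simps)
  show "finsum (ring_mat TYPE(real) n ()) X F \<in> carrier_mat n n"
    using closed assms(2) .
  show "finsum (ring_mat TYPE(real) n ()) X F *\<^sub>v v = finsum_vec TYPE(real) n (\<lambda>j. X j *\<^sub>v v) F"
    using assms
  proof (induction F rule: finite_induct)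
    case empty
    then show ?case
      using R.finsum_empty[of X] by (simp add: ring_mat_simps finsum_vec_empty zero_mult_mat_vec)
  next
    case (insert a F)
    have X: "X \<in> F \<rightarrow> carrier_mat n n" "X a \<in> carrier_mat n n"
      using insert by auto
    have "finsum (ring_mat TYPE(real) n ()) X (insert a F) = X a + finsum (ring_mat TYPE(real) n ()) X F"
      using R.finsum_insert[of F a X] insert(1,2) X by (simp add: ring_mat_simps)
    moreover have "(\<lambda>j. X j *\<^sub>v v) \<in> F \<rightarrow> carrier_vec n" "X a *\<^sub>v v \<in> carrier_vec n"
      using X insert(5) by (auto intro!: mult_mat_vec_carrier)
    ultimately show ?case
      using insert X closed
      by (simp add: finsum_vec_insert add_mult_distrib_mat_vec[of _ n n])
  qed
qed

lemma finsum_vec_change_one: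
  fixes X :: "'a \<Rightarrow> real vec"
  assumes "finite F" "a \<in> F" "X \<in> F \<rightarrow> carrier_vec n" "d \<in> carrier_vec n"
    and "Y a = X a + d" "\<And>j. j \<in> F \<Longrightarrow> j \<noteq> a \<Longrightarrow> Y j = X j"
  shows "finsum_vec TYPE(real) n Y F = finsum_vec TYPE(real) n X F + d"
proof -
  have Y: "Y \<in> F \<rightarrow> carrier_vec n"
  proof
    fix j assume "j \<in> F"
    moreover have "X a \<in> carrier_vec n" using assms(2,3) by auto
    ultimately show "Y j \<in> carrier_vec n"
      using assms by (cases "j = a") auto
  qed
  have XF: "finsum_vec TYPE(real) n X F \<in> carrier_vec n"
    and YF: "finsum_vec TYPE(real) n Y F \<in> carrier_vec n"
    using assms(3) Y by (auto intro!: finsum_vec_closed)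
  show ?thesis
  proof (rule eq_vecI)
    fix l assume "l < dim_vec (finsum_vec TYPE(real) n X F + d)"
    then have l: "l < n" using assms(4) by simp
    have "(\<Sum>j\<in>F. Y j $ l) = (\<Sum>j\<in>F. X j $ l) + d $ l"
      using assms l sum.cong[of "F - {a}" "F - {a}" "\<lambda>j. Y j $ l" "\<lambda>j. X j $ l"]
      by (simp add: sum.remove[of F a])
    then show "finsum_vec TYPE(real) n Y F $ l = (finsum_vec TYPE(real) n X F + d) $ l"
      using index_finsum_vec[OF assms(1) l assms(3)] index_finsum_vec[OF assms(1) l Y] assms(4) l XF
      by simp
  qed (use XF YF assms(4) in auto)
qed

lemma add_diff_assoc_vec:
  fixes a b c :: "real vec"
  assumes "a \<in> carrier_vec n" "b \<in> carrier_vec n" "c \<in> carrier_vec n"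
  shows "a + b - c = a + (b - c)"
  using assms by (intro eq_vecI) auto

lemma finsum_vec_cong:
  fixes X Y :: "'a \<Rightarrow> real vec"
  assumes "finite F" "X \<in> F \<rightarrow> carrier_vec n" "\<And>j. j \<in> F \<Longrightarrow> Y j = X j"
  shows "finsum_vec TYPE(real) n Y F = finsum_vec TYPE(real) n X F"
proof -
  have "Y \<in> F \<rightarrow> carrier_vec n" using assms by auto
  then show ?thesis
    using assms finsum_vec_closed[of X F n] finsum_vec_closed[of Y F n]
    by (intro eq_vecI) (auto simp: index_finsum_vec)
qed

lemma finsum_vec_diff:
  fixes X Y :: "'a \<Rightarrow> real vec"
  assumes "finite F" "X \<in> F \<rightarrow> carrier_vec n" "Y \<in> F \<rightarrow> carrier_vec n"
  shows "finsum_vec TYPE(real) n (\<lambda>j. - X j - Y j) F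
    = - finsum_vec TYPE(real) n X F - finsum_vec TYPE(real) n Y F"
proof -
  have [simp]: "dim_vec (X j) = n" "dim_vec (Y j) = n" if "j \<in> F" for j
    using assms(2,3)[THEN funcset_mem, OF that] by (simp_all add: carrier_vecD)
  then have Z: "(\<lambda>j. - X j - Y j) \<in> F \<rightarrow> carrier_vec n"
    by (auto intro!: carrier_vecI)
  show ?thesis
    using assms Z finsum_vec_closed[of X F n] finsum_vec_closed[of Y F n] finsum_vec_closed[OF Z]
    by (intro eq_vecI) (auto simp: index_finsum_vec sum_subtractf sum_negf)
qed

text \<open>Here x is the current value, y the deviation and z the target. Symmetry of S merges the
  two mixed terms in x and y, and moves y to the left in the target term, which yields the single
  linear term in x - z. Both the state part and the own-control part of a stage cost are
  instances.\<close>

lemma quadratic_expansion: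
  fixes S :: "real mat"
  assumes "S \<in> carrier_mat n n" "transpose_mat S = S"
    and "x \<in> carrier_vec n" "y \<in> carrier_vec n" "z \<in> carrier_vec n"
  shows "1/2 * ((x + y) \<bullet> (S *\<^sub>v (x + y))) - z \<bullet> (S *\<^sub>v (x + y)) =
    1/2 * (x \<bullet> (S *\<^sub>v x)) - z \<bullet> (S *\<^sub>v x) + y \<bullet> (S *\<^sub>v (x - z)) + 1/2 * (y \<bullet> (S *\<^sub>v y))"
proof -
  have sym: "a \<bullet> (S *\<^sub>v b) = b \<bullet> (S *\<^sub>v a)" if "a \<in> carrier_vec n" "b \<in> carrier_vec n" for a b
    using that assms(1,2) transpose_vec_mult_scalar[of S n n b a]
    by (metis comm_scalar_prod mult_mat_vec_carrier)
  have [simp]: "S *\<^sub>v x \<in> carrier_vec n" "S *\<^sub>v y \<in> carrier_vec n" "S *\<^sub>v z \<in> carrier_vec n"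
    using assms by auto
  show ?thesis
    using assms sym[of x y] sym[of z y]
    by (simp add: mult_add_distrib_mat_vec[of S n n] mult_minus_distrib_mat_vec[of S n n]
        add_scalar_prod_distrib[of _ n] scalar_prod_add_distrib[of _ n]
        scalar_prod_minus_distrib[of _ n])
qed

lemma pos_semidef_scalar_prod:
  assumes "A \<in> carrier_mat n n" "pos_semidef A" "v \<in> carrier_vec n"
  shows "v \<bullet> (A *\<^sub>v v) \<ge> 0"
  using assms unfolding pos_semidef_def by auto

lemma pos_def_scalar_prod:
  assumes "A \<in> carrier_mat n n" "pos_def A" "v \<in> carrier_vec n"
  shows "v \<bullet> (A *\<^sub>v v) \<ge> 0"
proof (cases "v = 0\<^sub>v n")
  case True
  then show ?thesis using assms by (simp add: mult_mat_vec_carrier[of A n n])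
next
  case False
  then show ?thesis
    using assms unfolding pos_def_def by (auto intro: less_imp_le)
qed

section \<open>First-order conditions\<close>

text \<open>The discrete adjoint variable: the derivative, with respect to the state at stage k, of
  the cost from stage k onwards with the controls held fixed. The trajectory is an arbitrary
  argument, so that the recursion can be studied apart from the dynamics.\<close>

function costate :: "aq_game \<Rightarrow> nat \<Rightarrow> (nat \<Rightarrow> real vec) \<Rightarrow> nat \<Rightarrow> real vec" where
  "costate G i x k = Qmat G k i *\<^sub>v (x k - xtgt G k i) +
     (if k < horizon G then transpose_mat (Amat G (Suc k)) *\<^sub>v costate G i x (Suc k) else 0\<^sub>v (sdim G))"
  by pat_completeness auto
termination
  by (relation "measure (\<lambda>(G, i, x, k). horizon G - k)") auto

declare costate.simps [simp del]

text \<open>Since the dynamics are affine, this is the exact change of the trajectory when player \<open>i\<close>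
  changes her controls by \<open>h\<close>.\<close>

fun deviation :: "aq_game \<Rightarrow> nat \<Rightarrow> (nat \<Rightarrow> real vec) \<Rightarrow> nat \<Rightarrow> real vec" where
  "deviation G i h 0 = 0\<^sub>v (sdim G)"
| "deviation G i h (Suc k) = Amat G (Suc k) *\<^sub>v deviation G i h k + Bmat G (Suc k) i *\<^sub>v h (Suc k)"

definition gradient :: "aq_game \<Rightarrow> real vec \<Rightarrow> (nat \<Rightarrow> nat \<Rightarrow> real vec) \<Rightarrow> nat \<Rightarrow> nat \<Rightarrow> real vec" where
  "gradient G x0 u i k = transpose_mat (Bmat G k i) *\<^sub>v costate G i (state G x0 u) k
     + Rmat G k i i *\<^sub>v (u i k - utgt G k i i)"

text \<open>The Hessian form of player i's cost in the direction h. As the cost is quadratic, it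
  depends neither on the profile nor on \<open>x0\<close>.\<close>

definition curvature :: "aq_game \<Rightarrow> nat \<Rightarrow> (nat \<Rightarrow> real vec) \<Rightarrow> real" where
  "curvature G i h = (\<Sum>k\<in>stages G. deviation G i h k \<bullet> (Qmat G k i *\<^sub>v deviation G i h k)
     + h k \<bullet> (Rmat G k i i *\<^sub>v h k))"

lemma Suc_in_stages [simp]: "Suc k \<in> stages G \<longleftrightarrow> k < horizon G"
  by (auto simp: stages_def)

lemma stages_cases:
  assumes "k \<in> stages G"
  obtains l where "k = Suc l" "l < horizon G"
  using assms unfolding stages_def by (cases k) auto

section \<open>Standing hypotheses and dimensions\<close>

locale game =
  fixes G :: aq_game and x0 :: "real vec"
  assumes wf: "wf_game G"
    and x0_carrier [simp]: "x0 \<in> carrier_vec (sdim G)"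
    and Q_pos_semidef: "k \<in> stages G \<Longrightarrow> i \<in> players G \<Longrightarrow> pos_semidef (Qmat G k i)"
    and R_pos_def: "k \<in> stages G \<Longrightarrow> i \<in> players G \<Longrightarrow> pos_def (Rmat G k i i)"
    and coupling_invertible: "k \<in> stages G \<Longrightarrow> invertible_mat (coupling G k (\<lambda>j. Mric G k j))"
begin

lemma finite_players [simp]: "finite (players G)"
  by (simp add: players_def)

lemma A_carrier [simp]: "k \<in> stages G \<Longrightarrow> Amat G k \<in> carrier_mat (sdim G) (sdim G)"
  and s_carrier [simp]: "k \<in> stages G \<Longrightarrow> svec G k \<in> carrier_vec (sdim G)"
  using wf unfolding wf_game_def by auto

lemma
  assumes "k \<in> stages G" "i \<in> players G"
  shows B_carrier [simp]: "Bmat G k i \<in> carrier_mat (sdim G) (cdim G i)"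
    and Q_carrier [simp]: "Qmat G k i \<in> carrier_mat (sdim G) (sdim G)"
    and Q_sym: "transpose_mat (Qmat G k i) = Qmat G k i"
    and xtgt_carrier [simp]: "xtgt G k i \<in> carrier_vec (sdim G)"
  using assms wf unfolding wf_game_def by auto

lemma
  assumes "k \<in> stages G" "i \<in> players G" "j \<in> players G"
  shows R_carrier [simp]: "Rmat G k i j \<in> carrier_mat (cdim G j) (cdim G j)"
    and R_sym: "transpose_mat (Rmat G k i j) = Rmat G k i j"
    and utgt_carrier [simp]: "utgt G k i j \<in> carrier_vec (cdim G j)"
  using assms wf unfolding wf_game_def by blast+

lemma A_mult [simp]:
  assumes "k \<in> stages G" "v \<in> carrier_vec (sdim G)"
  shows "Amat G k *\<^sub>v v \<in> carrier_vec (sdim G)"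
    and "transpose_mat (Amat G k) *\<^sub>v v \<in> carrier_vec (sdim G)"
  using A_carrier[OF assms(1)] assms(2)
  by (meson mult_mat_vec_carrier transpose_carrier_mat)+

lemma Q_mult [simp]:
  "k \<in> stages G \<Longrightarrow> i \<in> players G \<Longrightarrow> v \<in> carrier_vec (sdim G) \<Longrightarrow>
    Qmat G k i *\<^sub>v v \<in> carrier_vec (sdim G)"
  using Q_carrier mult_mat_vec_carrier by blast

lemma B_mult [simp]:
  "k \<in> stages G \<Longrightarrow> i \<in> players G \<Longrightarrow> v \<in> carrier_vec (cdim G i) \<Longrightarrow>
    Bmat G k i *\<^sub>v v \<in> carrier_vec (sdim G)"
  using B_carrier mult_mat_vec_carrier by blast

lemma BT_mult [simp]:
  "k \<in> stages G \<Longrightarrow> i \<in> players G \<Longrightarrow> v \<in> carrier_vec (sdim G) \<Longrightarrow>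
    transpose_mat (Bmat G k i) *\<^sub>v v \<in> carrier_vec (cdim G i)"
  using B_carrier mult_mat_vec_carrier transpose_carrier_mat by blast

lemma R_mult [simp]:
  "k \<in> stages G \<Longrightarrow> i \<in> players G \<Longrightarrow> j \<in> players G \<Longrightarrow> v \<in> carrier_vec (cdim G j) \<Longrightarrow>
    Rmat G k i j *\<^sub>v v \<in> carrier_vec (cdim G j)"
  using R_carrier mult_mat_vec_carrier by blast

lemma Rinv_carrier [simp]:
  "k \<in> stages G \<Longrightarrow> i \<in> players G \<Longrightarrow> minv (Rmat G k i i) \<in> carrier_mat (cdim G i) (cdim G i)"
  using minv_inverse(1) pos_def_invertible R_pos_def R_carrier by blast

lemma Rinv_mult [simp]:
  "k \<in> stages G \<Longrightarrow> i \<in> players G \<Longrightarrow> v \<in> carrier_vec (cdim G i) \<Longrightarrow>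
    minv (Rmat G k i i) *\<^sub>v v \<in> carrier_vec (cdim G i)"
  using Rinv_carrier mult_mat_vec_carrier by blast

lemma profile_carrier [simp]:
  "u \<in> profiles G \<Longrightarrow> i \<in> players G \<Longrightarrow> k \<in> stages G \<Longrightarrow> u i k \<in> carrier_vec (cdim G i)"
  unfolding profiles_def strategies_def by (blast dest: PiE_mem)

lemma strategy_carrier:
  "v \<in> strategies G i \<Longrightarrow> k \<in> stages G \<Longrightarrow> v k \<in> carrier_vec (cdim G i)"
  unfolding strategies_def by (blast dest: PiE_mem)

lemma state_carrier [simp]:
  assumes "u \<in> profiles G" "k \<le> horizon G"
  shows "state G x0 u k \<in> carrier_vec (sdim G)"
  using assms(2)
proof (induction k)
  case (Suc k)
  then show ?case
    using assms(1) by (auto intro!: add_carrier_vec finsum_vec_closed)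
qed simp

lemma state_carrier' [simp]:
  "u \<in> profiles G \<Longrightarrow> k \<in> stages G \<Longrightarrow> state G x0 u k \<in> carrier_vec (sdim G)"
  by (rule state_carrier) (auto simp: stages_def)

lemma costate_carrier:
  assumes "i \<in> players G" "\<And>k. k \<le> horizon G \<Longrightarrow> x k \<in> carrier_vec (sdim G)" "k \<in> stages G"
  shows "costate G i x k \<in> carrier_vec (sdim G)"
  using assms(3)
proof (induction "horizon G - k" arbitrary: k)
  case 0
  then show ?case
    using assms by (subst costate.simps) (auto simp: stages_def)
next
  case (Suc n)
  have "x k \<in> carrier_vec (sdim G)"
    using Suc assms(2) by (auto simp: stages_def)
  moreover have "costate G i x (Suc k) \<in> carrier_vec (sdim G)" "k < horizon G"
    using Suc(2) Suc(1)[of "Suc k"] by auto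
  ultimately show ?case
    using assms(1) Suc by (subst costate.simps) auto
qed

lemma costate_state_carrier [simp]:
  "u \<in> profiles G \<Longrightarrow> i \<in> players G \<Longrightarrow> k \<in> stages G \<Longrightarrow>
    costate G i (state G x0 u) k \<in> carrier_vec (sdim G)"
  by (rule costate_carrier) auto

lemma deviation_carrier [simp]:
  assumes "i \<in> players G" "\<And>k. k \<in> stages G \<Longrightarrow> h k \<in> carrier_vec (cdim G i)" "k \<le> horizon G"
  shows "deviation G i h k \<in> carrier_vec (sdim G)"
  using assms(3) by (induction k) (auto simp: assms(1,2))

lemma gradient_carrier:
  "u \<in> profiles G \<Longrightarrow> i \<in> players G \<Longrightarrow> k \<in> stages G \<Longrightarrow> gradient G x0 u i k \<in> carrier_vec (cdim G i)"
  unfolding gradient_def by (intro add_carrier_vec) auto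

section \<open>Exact cost change under a unilateral deviation\<close>

lemma state_deviation:
  assumes u: "u \<in> profiles G" and i: "i \<in> players G"
    and h: "\<And>k. k \<in> stages G \<Longrightarrow> h k \<in> carrier_vec (cdim G i)"
    and v: "\<And>k. k \<in> stages G \<Longrightarrow> v k = u i k + h k"
    and "k \<le> horizon G"
  shows "state G x0 (u(i := v)) k = state G x0 u k + deviation G i h k"
  using assms(5)
proof (induction k)
  case (Suc k)
  let ?F = "finsum_vec TYPE(real) (sdim G) (\<lambda>j. Bmat G (Suc k) j *\<^sub>v u j (Suc k)) (players G)"
  have k: "Suc k \<in> stages G" using Suc by simp
  have F: "finsum_vec TYPE(real) (sdim G) (\<lambda>j. Bmat G (Suc k) j *\<^sub>v (u(i := v)) j (Suc k)) (players G)
    = ?F + Bmat G (Suc k) i *\<^sub>v h (Suc k)"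
    using u i h[OF k] v[OF k] k
    by (intro finsum_vec_change_one[of _ i])
      (auto simp: mult_add_distrib_mat_vec[OF B_carrier[OF k i]])
  have [simp]: "?F \<in> carrier_vec (sdim G)"
    using u k by (auto intro!: finsum_vec_closed)
  have [simp]: "deviation G i h k \<in> carrier_vec (sdim G)" "state G x0 u k \<in> carrier_vec (sdim G)"
    using i h u Suc by auto
  have [simp]: "Bmat G (Suc k) i *\<^sub>v h (Suc k) \<in> carrier_vec (sdim G)"
    using i h k by auto
  have shuffle: "(a + b) + (f + c) + s = (a + f + s) + (b + c)"
    if "a \<in> carrier_vec n" "b \<in> carrier_vec n" "c \<in> carrier_vec n" "f \<in> carrier_vec n" "s \<in> carrier_vec n"
    for a b c f s :: "real vec" and n
    using that by (intro eq_vecI) auto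
  have "Amat G (Suc k) *\<^sub>v state G x0 (u(i := v)) k
      = Amat G (Suc k) *\<^sub>v state G x0 u k + Amat G (Suc k) *\<^sub>v deviation G i h k"
    using Suc by (simp add: mult_add_distrib_mat_vec[OF A_carrier[OF k]] del: fun_upd_apply)
  then show ?case
    unfolding state.simps deviation.simps F using k
    by (simp only:) (intro shuffle[where n = "sdim G"]; simp)
qed (use x0_carrier in simp)

lemma stage_cost_deviation:
  assumes k: "k \<in> stages G" and i: "i \<in> players G"
    and w: "\<And>j. j \<in> players G \<Longrightarrow> w j \<in> carrier_vec (cdim G j)"
    and h: "h \<in> carrier_vec (cdim G i)" and x: "x \<in> carrier_vec (sdim G)" and y: "y \<in> carrier_vec (sdim G)"
    and w': "w' i = w i + h" "\<And>j. j \<noteq> i \<Longrightarrow> w' j = w j"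
  shows "stage_cost G i k (x + y) w' = stage_cost G i k x w
    + y \<bullet> (Qmat G k i *\<^sub>v (x - xtgt G k i)) + h \<bullet> (Rmat G k i i *\<^sub>v (w i - utgt G k i i))
    + 1/2 * (y \<bullet> (Qmat G k i *\<^sub>v y) + h \<bullet> (Rmat G k i i *\<^sub>v h))"
proof -
  \<comment> \<open>The deviating player's summand is split off each control sum; the remaining
    summands agree before and after the deviation and cancel.\<close>
  have *: "(\<Sum>j\<in>players G. c j (w' j)) = c i (w i + h) + (\<Sum>j\<in>players G - {i}. c j (w j))"
    for c :: "nat \<Rightarrow> real vec \<Rightarrow> real"
    using i w' by (simp add: sum.remove[of _ i])
  have **: "(\<Sum>j\<in>players G. c j (w j)) = c i (w i) + (\<Sum>j\<in>players G - {i}. c j (w j))"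
    for c :: "nat \<Rightarrow> real vec \<Rightarrow> real"
    using i by (simp add: sum.remove[of _ i])
  show ?thesis
    unfolding stage_cost_def
      *[of "\<lambda>j v. v \<bullet> (Rmat G k i j *\<^sub>v v)"] **[of "\<lambda>j v. v \<bullet> (Rmat G k i j *\<^sub>v v)"]
      *[of "\<lambda>j v. utgt G k i j \<bullet> (Rmat G k i j *\<^sub>v v)"] **[of "\<lambda>j v. utgt G k i j \<bullet> (Rmat G k i j *\<^sub>v v)"]
    using quadratic_expansion[OF Q_carrier[OF k i] Q_sym[OF k i] x y xtgt_carrier[OF k i]]
      quadratic_expansion[OF R_carrier[OF k i i] R_sym[OF k i i] w[OF i] h utgt_carrier[OF k i i]]
    by (simp add: algebra_simps)
qed

text \<open>Summation by parts: the costate turns the state terms of the cost variation into control terms.\<close>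

lemma deviation_costate_sum:
  assumes i: "i \<in> players G" and x: "\<And>k. k \<le> horizon G \<Longrightarrow> x k \<in> carrier_vec (sdim G)"
    and h: "\<And>k. k \<in> stages G \<Longrightarrow> h k \<in> carrier_vec (cdim G i)"
  shows "(\<Sum>k\<in>stages G. deviation G i h k \<bullet> (Qmat G k i *\<^sub>v (x k - xtgt G k i)))
    = (\<Sum>k\<in>stages G. h k \<bullet> (transpose_mat (Bmat G k i) *\<^sub>v costate G i x k))"
proof -
  define D where "D k = deviation G i h k" for k
  define p where "p = costate G i x"
  define q where "q k = Qmat G k i *\<^sub>v (x k - xtgt G k i)" for k
  define r where "r k = (if k < horizon G then transpose_mat (Amat G (Suc k)) *\<^sub>v p (Suc k) else 0\<^sub>v (sdim G))" for k
  have D: "D k \<in> carrier_vec (sdim G)" if "k \<le> horizon G" for k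
    unfolding D_def using i h that by simp
  have p: "p k \<in> carrier_vec (sdim G)" if "k \<in> stages G" for k
    unfolding p_def using costate_carrier i x that by blast
  have q: "q k \<in> carrier_vec (sdim G)" if "k \<in> stages G" for k
    unfolding q_def using i x that by (auto simp: stages_def)
  have r: "r k \<in> carrier_vec (sdim G)" for k
    unfolding r_def using p by simp
  have pqr: "p k = q k + r k" for k
    unfolding p_def q_def r_def by (subst costate.simps) simp
  \<comment> \<open>The boundary term is the effect of the deviation at stage n on the later stages.
    It starts at zero because \<open>D 0\<close> is zero, and it disappears at the horizon because
    \<open>r\<close> is zero there.\<close>
  have "(\<Sum>k\<in>{1..n}. D k \<bullet> q k) + D n \<bullet> r n
      = (\<Sum>k\<in>{1..n}. h k \<bullet> (transpose_mat (Bmat G k i) *\<^sub>v p k))" if "n \<le> horizon G" for n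
    using that
  proof (induction n)
    case 0
    then show ?case
      using r[of 0] by (simp add: D_def)
  next
    case (Suc n)
    have n: "Suc n \<in> stages G" using Suc by simp
    have "D n \<bullet> r n = (Amat G (Suc n) *\<^sub>v D n) \<bullet> p (Suc n)"
      using transpose_vec_mult_scalar[OF A_carrier[OF n] D p[OF n], of n] Suc
        comm_scalar_prod[OF D r, of n n]
        comm_scalar_prod[OF p[OF n] A_mult(1)[OF n D], of n]
      by (simp add: r_def)
    moreover have "h (Suc n) \<bullet> (transpose_mat (Bmat G (Suc n) i) *\<^sub>v p (Suc n))
        = (Bmat G (Suc n) i *\<^sub>v h (Suc n)) \<bullet> p (Suc n)"
      using transpose_vec_mult_scalar[OF B_carrier[OF n i] h[OF n] p[OF n]]
        comm_scalar_prod[OF h[OF n] BT_mult[OF n i p[OF n]]]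
        comm_scalar_prod[OF p[OF n] B_mult[OF n i h[OF n]]] by simp
    moreover have "D (Suc n) \<bullet> p (Suc n) = (Amat G (Suc n) *\<^sub>v D n) \<bullet> p (Suc n)
        + (Bmat G (Suc n) i *\<^sub>v h (Suc n)) \<bullet> p (Suc n)"
      using n D[of n] p[OF n] h[OF n] i
      by (simp add: D_def add_scalar_prod_distrib[of _ "sdim G"])
    moreover have "D (Suc n) \<bullet> p (Suc n) = D (Suc n) \<bullet> q (Suc n) + D (Suc n) \<bullet> r (Suc n)"
      using scalar_prod_add_distrib[OF D q[OF n] r, of "Suc n" "Suc n"] n
      by (simp add: pqr[of "Suc n"])
    ultimately show ?case
      using Suc by simp
  qed
  from this[of "horizon G"] have "(\<Sum>k\<in>stages G. D k \<bullet> q k)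
      = (\<Sum>k\<in>stages G. h k \<bullet> (transpose_mat (Bmat G k i) *\<^sub>v p k))"
    using D[of "horizon G"] by (simp add: stages_def r_def)
  then show ?thesis
    unfolding D_def q_def p_def .
qed

text \<open>A second-order Taylor formula without remainder. It serves both directions of the
  first-order characterization: with h a multiple of the gradient for necessity, and with h the
  difference of two strategies for sufficiency.\<close>

lemma total_cost_deviation:
  assumes u: "u \<in> profiles G" and i: "i \<in> players G"
    and h: "\<And>k. k \<in> stages G \<Longrightarrow> h k \<in> carrier_vec (cdim G i)"
    and v: "\<And>k. k \<in> stages G \<Longrightarrow> v k = u i k + h k"
  shows "total_cost G x0 i (u(i := v)) = total_cost G x0 i u
    + (\<Sum>k\<in>stages G. h k \<bullet> gradient G x0 u i k) + 1/2 * curvature G i h"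
proof -
  let ?x = "state G x0 u" and ?D = "deviation G i h"
  have step: "stage_cost G i k (state G x0 (u(i := v)) k) (\<lambda>j. (u(i := v)) j k)
      = stage_cost G i k (?x k) (\<lambda>j. u j k)
        + ?D k \<bullet> (Qmat G k i *\<^sub>v (?x k - xtgt G k i)) + h k \<bullet> (Rmat G k i i *\<^sub>v (u i k - utgt G k i i))
        + 1/2 * (?D k \<bullet> (Qmat G k i *\<^sub>v ?D k) + h k \<bullet> (Rmat G k i i *\<^sub>v h k))"
    if k: "k \<in> stages G" for k
  proof -
    have kT: "k \<le> horizon G" using k by (auto simp: stages_def)
    have x: "state G x0 (u(i := v)) k = ?x k + ?D k"
      using h v kT by (intro state_deviation[OF u i])
    show ?thesis
      unfolding x
      by (rule stage_cost_deviation[OF k i])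
        (use u i k h[OF k] v[OF k] deviation_carrier[where h = h, OF i h kT] in auto)
  qed
  have grad: "h k \<bullet> gradient G x0 u i k = h k \<bullet> (transpose_mat (Bmat G k i) *\<^sub>v costate G i ?x k)
      + h k \<bullet> (Rmat G k i i *\<^sub>v (u i k - utgt G k i i))" if k: "k \<in> stages G" for k
    unfolding gradient_def using u i k h[OF k]
    by (intro scalar_prod_add_distrib[of _ "cdim G i"]) auto
  have "(\<Sum>k\<in>stages G. ?D k \<bullet> (Qmat G k i *\<^sub>v (?x k - xtgt G k i)))
      = (\<Sum>k\<in>stages G. h k \<bullet> (transpose_mat (Bmat G k i) *\<^sub>v costate G i ?x k))"
    using i h u by (intro deviation_costate_sum) auto
  then show ?thesis
    unfolding total_cost_def curvature_def
    by (simp add: step grad sum.distrib add_divide_distrib sum_divide_distrib del: fun_upd_apply)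
qed

section \<open>Equilibria as profiles with vanishing gradients\<close>

lemma curvature_nonneg:
  assumes i: "i \<in> players G" and h: "\<And>k. k \<in> stages G \<Longrightarrow> h k \<in> carrier_vec (cdim G i)"
  shows "curvature G i h \<ge> 0"
  unfolding curvature_def
proof (intro sum_nonneg add_nonneg_nonneg)
  fix k assume k: "k \<in> stages G"
  then have "deviation G i h k \<in> carrier_vec (sdim G)"
    using i h by (intro deviation_carrier) (auto simp: stages_def)
  then show "0 \<le> deviation G i h k \<bullet> (Qmat G k i *\<^sub>v deviation G i h k)"
    using pos_semidef_scalar_prod Q_carrier Q_pos_semidef k i by blast
  show "0 \<le> h k \<bullet> (Rmat G k i i *\<^sub>v h k)"
    using pos_def_scalar_prod R_carrier R_pos_def k i h by blast
qed

lemma deviation_smult: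
  assumes i: "i \<in> players G" and h: "\<And>k. k \<in> stages G \<Longrightarrow> h k \<in> carrier_vec (cdim G i)"
    and "k \<le> horizon G"
  shows "deviation G i (\<lambda>k. t \<cdot>\<^sub>v h k) k = t \<cdot>\<^sub>v deviation G i h k"
  using assms(3)
proof (induction k)
  case (Suc k)
  then have k: "Suc k \<in> stages G" and D: "deviation G i h k \<in> carrier_vec (sdim G)"
    using i h by auto
  show ?case
    using Suc smult_add_distrib_vec[OF A_mult(1)[OF k D] B_mult[OF k i h[OF k]]]
    by (simp add: mult_mat_vec[OF A_carrier[OF k] D] mult_mat_vec[OF B_carrier[OF k i] h[OF k]])
qed (auto intro!: eq_vecI)

lemma curvature_smult:
  assumes i: "i \<in> players G" and h: "\<And>k. k \<in> stages G \<Longrightarrow> h k \<in> carrier_vec (cdim G i)"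
  shows "curvature G i (\<lambda>k. t \<cdot>\<^sub>v h k) = t\<^sup>2 * curvature G i h"
proof -
  have "(t \<cdot>\<^sub>v a) \<bullet> (S *\<^sub>v (t \<cdot>\<^sub>v a)) = t\<^sup>2 * (a \<bullet> (S *\<^sub>v a))"
    if "S \<in> carrier_mat n n" "a \<in> carrier_vec n" for S :: "real mat" and a n
    using that mult_mat_vec_carrier[OF that]
    by (simp add: mult_mat_vec[of S n n] power2_eq_square)
  note scale = this
  show ?thesis
    unfolding curvature_def sum_distrib_left
  proof (intro sum.cong refl)
    fix k assume k: "k \<in> stages G"
    then have kT: "k \<le> horizon G" by (auto simp: stages_def)
    show "deviation G i (\<lambda>k. t \<cdot>\<^sub>v h k) k \<bullet> (Qmat G k i *\<^sub>v deviation G i (\<lambda>k. t \<cdot>\<^sub>v h k) k)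
        + (t \<cdot>\<^sub>v h k) \<bullet> (Rmat G k i i *\<^sub>v (t \<cdot>\<^sub>v h k))
      = t\<^sup>2 * (deviation G i h k \<bullet> (Qmat G k i *\<^sub>v deviation G i h k) + h k \<bullet> (Rmat G k i i *\<^sub>v h k))"
      by (simp add: deviation_smult[OF i h kT] scale[OF Q_carrier[OF k i] deviation_carrier[where h = h, OF i h kT]]
          scale[OF R_carrier[OF k i i] h[OF k]] distrib_left)
  qed
qed

text \<open>One test direction suffices: the gradient g itself, over all stages at once. Along t g
  the cost changes by t a + t^2 c / 2, where a is the squared norm of g and c its curvature; if a
  were positive, a small negative t would be an improvement.\<close>

lemma nash_imp_gradient_zero:
  assumes nash: "open_loop_nash G x0 u" and i: "i \<in> players G" and k: "k \<in> stages G"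
  shows "gradient G x0 u i k = 0\<^sub>v (cdim G i)"
proof -
  have u: "u \<in> profiles G" using nash by (simp add: open_loop_nash_def)
  define g where "g = gradient G x0 u i"
  have g: "g k \<in> carrier_vec (cdim G i)" if "k \<in> stages G" for k
    unfolding g_def using gradient_carrier u i that .
  define a where "a = (\<Sum>k\<in>stages G. g k \<bullet> g k)"
  have a0: "a \<ge> 0"
    unfolding a_def by (intro sum_nonneg scalar_prod_self_ge_0)
  have ineq: "0 \<le> t * a + 1/2 * (t\<^sup>2 * curvature G i g)" for t
  proof -
    define v where "v = (\<lambda>k\<in>stages G. u i k + t \<cdot>\<^sub>v g k)"
    have tg: "t \<cdot>\<^sub>v g k \<in> carrier_vec (cdim G i)" if "k \<in> stages G" for k
      using g that by simp
    have "v \<in> strategies G i"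
      unfolding v_def strategies_def using u i tg by (auto intro!: restrict_PiE add_carrier_vec)
    then have "total_cost G x0 i u \<le> total_cost G x0 i (u(i := v))"
      using nash i by (auto simp: open_loop_nash_def)
    also have "\<dots> = total_cost G x0 i u + (\<Sum>k\<in>stages G. (t \<cdot>\<^sub>v g k) \<bullet> g k)
        + 1/2 * curvature G i (\<lambda>k. t \<cdot>\<^sub>v g k)"
      unfolding g_def by (intro total_cost_deviation[OF u i]) (use tg in \<open>auto simp: v_def g_def\<close>)
    also have "(\<Sum>k\<in>stages G. (t \<cdot>\<^sub>v g k) \<bullet> g k) = t * a"
      unfolding a_def sum_distrib_left using g by (intro sum.cong) auto
    finally show ?thesis
      using curvature_smult[OF i g] by simp
  qed
  have "a = 0"
  proof (rule ccontr)
    assume "a \<noteq> 0"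
    with a0 have a: "a > 0" by simp
    define c where "c = curvature G i g"
    have c: "c \<ge> 0" unfolding c_def using curvature_nonneg[OF i g] .
    \<comment> \<open>The choice gives a = -t (c + 1), so the cost change is exactly -t^2 (1 + c /
      2). The added 1 keeps the denominator positive when the curvature is zero.\<close>
    define t where "t = - a / (c + 1)"
    have "t \<noteq> 0" "a = - t * (c + 1)"
      using a c by (auto simp: t_def)
    then have "t * a + 1/2 * (t\<^sup>2 * c) = - (t\<^sup>2 * (1 + c / 2))"
      by (simp only:) (simp add: power2_eq_square algebra_simps)
    also have "\<dots> < 0"
      using \<open>t \<noteq> 0\<close> c by simp
    finally have "t * a + 1/2 * (t\<^sup>2 * c) < 0" .
    then show False
      using ineq[of t] by (simp add: c_def)
  qed
  then have "g k \<bullet> g k = 0"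
    unfolding a_def using k
    by (subst (asm) sum_nonneg_eq_0_iff) (auto simp: scalar_prod_self_ge_0 stages_def)
  then show ?thesis
    using scalar_prod_self_eq_0 g[OF k] by (simp add: g_def)
qed

lemma gradient_zero_imp_nash:
  assumes u: "u \<in> profiles G"
    and zero: "\<And>i k. i \<in> players G \<Longrightarrow> k \<in> stages G \<Longrightarrow> gradient G x0 u i k = 0\<^sub>v (cdim G i)"
  shows "open_loop_nash G x0 u"
  unfolding open_loop_nash_def
proof (intro conjI u ballI)
  fix i v assume i: "i \<in> players G" and v: "v \<in> strategies G i"
  define h where "h k = v k - u i k" for k
  have h: "h k \<in> carrier_vec (cdim G i)" if "k \<in> stages G" for k
    unfolding h_def using strategy_carrier[OF v that] profile_carrier[OF u i that] by simp
  have "v k = u i k + h k" if "k \<in> stages G" for k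
    unfolding h_def using strategy_carrier[OF v that] profile_carrier[OF u i that]
    by (intro eq_vecI) auto
  then have "total_cost G x0 i (u(i := v)) = total_cost G x0 i u
      + (\<Sum>k\<in>stages G. h k \<bullet> gradient G x0 u i k) + 1/2 * curvature G i h"
    using h by (intro total_cost_deviation[OF u i])
  moreover have "(\<Sum>k\<in>stages G. h k \<bullet> gradient G x0 u i k) = 0"
    using zero[OF i] h by simp
  ultimately show "total_cost G x0 i u \<le> total_cost G x0 i (u(i := v))"
    using curvature_nonneg[OF i h] by simp
qed

end

section \<open>The Riccati feedback\<close>

text \<open>\<open>mric\<close> omits the target term of its own stage, since its recursion adds
  that term one stage earlier; therefore it is subtracted here.\<close>

definition feedback_costate :: "aq_game \<Rightarrow> nat \<Rightarrow> nat \<Rightarrow> real vec \<Rightarrow> real vec" where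
  "feedback_costate G i k y = Mric G k i *\<^sub>v y + mric G k i - Qmat G k i *\<^sub>v xtgt G k i"

definition feedback_control :: "aq_game \<Rightarrow> nat \<Rightarrow> nat \<Rightarrow> real vec \<Rightarrow> real vec" where
  "feedback_control G i k y = utgt G k i i
     - minv (Rmat G k i i) *\<^sub>v (transpose_mat (Bmat G k i) *\<^sub>v feedback_costate G i k y)"

context game
begin

text \<open>The products are bracketed to the right to match the nested applications in
  \<open>feedback_control\<close>. M stays arbitrary so that the dimension of the coupling matrix is
  available before that of \<open>Mric\<close> is established.\<close>

lemma
  assumes k: "k \<in> stages G" and M: "\<And>j. j \<in> players G \<Longrightarrow> M j \<in> carrier_mat (sdim G) (sdim G)"
  shows coupling_carrier: "coupling G k M \<in> carrier_mat (sdim G) (sdim G)"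
    and coupling_mult_vec: "y \<in> carrier_vec (sdim G) \<Longrightarrow> coupling G k M *\<^sub>v y =
      y + finsum_vec TYPE(real) (sdim G)
        (\<lambda>j. Bmat G k j *\<^sub>v (minv (Rmat G k j j) *\<^sub>v (transpose_mat (Bmat G k j) *\<^sub>v (M j *\<^sub>v y)))) (players G)"
proof -
  let ?X = "\<lambda>j. Bmat G k j * minv (Rmat G k j j) * transpose_mat (Bmat G k j) * M j"
  have BR: "Bmat G k j * minv (Rmat G k j j) \<in> carrier_mat (sdim G) (cdim G j)"
    and BRB: "Bmat G k j * minv (Rmat G k j j) * transpose_mat (Bmat G k j) \<in> carrier_mat (sdim G) (sdim G)"
    and BRBM: "?X j \<in> carrier_mat (sdim G) (sdim G)" if "j \<in> players G" for j
    using B_carrier[OF k that] Rinv_carrier[OF k that] M[OF that]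
    by (auto intro!: mult_carrier_mat transpose_carrier_mat)
  have X: "?X \<in> players G \<rightarrow> carrier_mat (sdim G) (sdim G)"
    using BRBM by auto
  note F = finsum_ring_mat_mult_vec[OF finite_players X]
  \<comment> \<open>The sum lemma has a premise about a vector even in its dimension part; the zero
    vector discharges it.\<close>
  show "coupling G k M \<in> carrier_mat (sdim G) (sdim G)"
    unfolding coupling_def using F(1)[of "0\<^sub>v (sdim G)"] by simp
  assume y: "y \<in> carrier_vec (sdim G)"
  have Xy: "Bmat G k j *\<^sub>v (minv (Rmat G k j j) *\<^sub>v (transpose_mat (Bmat G k j) *\<^sub>v (M j *\<^sub>v y)))
      = ?X j *\<^sub>v y" if j: "j \<in> players G" for j
  proof -
    have My: "M j *\<^sub>v y \<in> carrier_vec (sdim G)"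
      using M[OF j] y by (rule mult_mat_vec_carrier)
    have BT: "transpose_mat (Bmat G k j) \<in> carrier_mat (cdim G j) (sdim G)"
      using B_carrier[OF k j] by simp
    show ?thesis
      using assoc_mult_mat_vec[OF BRB[OF j] M[OF j] y] assoc_mult_mat_vec[OF BR[OF j] BT My]
        assoc_mult_mat_vec[OF B_carrier[OF k j] Rinv_carrier[OF k j] BT_mult[OF k j My]]
      by simp
  qed
  have "(\<lambda>j. ?X j *\<^sub>v y) \<in> players G \<rightarrow> carrier_vec (sdim G)"
    using BRBM y mult_mat_vec_carrier by blast
  from finsum_vec_cong[OF finite_players this, OF Xy]
  show "coupling G k M *\<^sub>v y = y + finsum_vec TYPE(real) (sdim G)
        (\<lambda>j. Bmat G k j *\<^sub>v (minv (Rmat G k j j) *\<^sub>v (transpose_mat (Bmat G k j) *\<^sub>v (M j *\<^sub>v y)))) (players G)"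
    unfolding coupling_def using F[OF y] y
    by (simp add: add_mult_distrib_mat_vec[of _ "sdim G" "sdim G"])
qed

text \<open>Conditional because of the mutual recursion: the dimensions of \<open>Mric\<close> at
  k+1 give that of \<open>Phi\<close> at k, which in turn gives those of \<open>Mric\<close> at k.
  The affine terms \<open>phi\<close> and \<open>mric\<close> are treated alike.\<close>

lemma Phi_carrier_if:
  assumes "k < horizon G" "\<And>j. j \<in> players G \<Longrightarrow> Mric G (Suc k) j \<in> carrier_mat (sdim G) (sdim G)"
  shows "Phi G k \<in> carrier_mat (sdim G) (sdim G)"
proof -
  have k: "Suc k \<in> stages G" using assms by simp
  show ?thesis
    using minv_inverse(1)[OF coupling_carrier[OF k assms(2)] coupling_invertible[OF k]]
      A_carrier[OF k] assms(1)
    by (subst Phi.simps) simp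
qed

lemma Mric_carrier [simp]:
  assumes "i \<in> players G" "k \<le> horizon G"
  shows "Mric G k i \<in> carrier_mat (sdim G) (sdim G)"
  using assms
proof (induction "horizon G - k" arbitrary: k i)
  case 0
  then show ?case
    \<comment> \<open>This includes a game with horizon 0, where \<open>Qext\<close> returns the
      zero matrix.\<close>
    by (subst Mric.simps) (auto simp: Qext_def stages_def)
next
  case (Suc n)
  then have k: "Suc k \<in> stages G" "k < horizon G" by auto
  have M: "Mric G (Suc k) j \<in> carrier_mat (sdim G) (sdim G)" if "j \<in> players G" for j
    using Suc(1)[of "Suc k" j] Suc(2) that by auto
  have "transpose_mat (Amat G (Suc k)) \<in> carrier_mat (sdim G) (sdim G)"
    using A_carrier[OF k(1)] by simp
  from mult_carrier_mat[OF mult_carrier_mat[OF this M[OF Suc(3)]] Phi_carrier_if[OF k(2) M]]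
  show ?case
    using k(2) by (subst Mric.simps) (simp add: add_carrier_mat)
qed

lemma Phi_carrier [simp]: "k < horizon G \<Longrightarrow> Phi G k \<in> carrier_mat (sdim G) (sdim G)"
  by (rule Phi_carrier_if) auto

lemma Mric_mult [simp]:
  "i \<in> players G \<Longrightarrow> k \<le> horizon G \<Longrightarrow> v \<in> carrier_vec (sdim G) \<Longrightarrow> Mric G k i *\<^sub>v v \<in> carrier_vec (sdim G)"
  using Mric_carrier mult_mat_vec_carrier by blast

lemma Phi_mult [simp]:
  "k < horizon G \<Longrightarrow> v \<in> carrier_vec (sdim G) \<Longrightarrow> Phi G k *\<^sub>v v \<in> carrier_vec (sdim G)"
  using Phi_carrier mult_mat_vec_carrier by blast

lemma coupling_Mric:
  assumes "k < horizon G"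
  shows "coupling G (Suc k) (\<lambda>j. Mric G (Suc k) j) \<in> carrier_mat (sdim G) (sdim G)"
    and "minv (coupling G (Suc k) (\<lambda>j. Mric G (Suc k) j)) \<in> carrier_mat (sdim G) (sdim G)"
proof -
  show *: "coupling G (Suc k) (\<lambda>j. Mric G (Suc k) j) \<in> carrier_mat (sdim G) (sdim G)"
    using assms by (intro coupling_carrier) auto
  show "minv (coupling G (Suc k) (\<lambda>j. Mric G (Suc k) j)) \<in> carrier_mat (sdim G) (sdim G)"
    using minv_inverse(1)[OF * coupling_invertible] assms by simp
qed

lemma phi_carrier_if:
  assumes k: "k < horizon G" and m: "\<And>j. j \<in> players G \<Longrightarrow> mric G (Suc k) j \<in> carrier_vec (sdim G)"
  shows "phi G k \<in> carrier_vec (sdim G)"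
proof -
  have kS: "Suc k \<in> stages G" using k by simp
  have "svec G (Suc k) - finsum_vec TYPE(real) (sdim G)
      (\<lambda>j. Bmat G (Suc k) j *\<^sub>v (minv (Rmat G (Suc k) j j) *\<^sub>v (transpose_mat (Bmat G (Suc k) j) *\<^sub>v
         (mric G (Suc k) j - Qmat G (Suc k) j *\<^sub>v xtgt G (Suc k) j)) - utgt G (Suc k) j j)) (players G)
      \<in> carrier_vec (sdim G)"
    using kS m by (intro minus_carrier_vec finsum_vec_closed) auto
  then show ?thesis
    using k mult_mat_vec_carrier[OF coupling_Mric(2)[OF k]] by (subst phi.simps) simp
qed

lemma mric_carrier [simp]:
  assumes "i \<in> players G" "k \<le> horizon G"
  shows "mric G k i \<in> carrier_vec (sdim G)"
  using assms
proof (induction "horizon G - k" arbitrary: k i)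
  case 0
  then show ?case
    by (subst mric.simps) auto
next
  case (Suc n)
  then have k: "Suc k \<in> stages G" "k < horizon G" by auto
  have "mric G (Suc k) j \<in> carrier_vec (sdim G)" if "j \<in> players G" for j
    using Suc(1)[of "Suc k" j] Suc(2) that by auto
  moreover from this have "phi G k \<in> carrier_vec (sdim G)"
    using phi_carrier_if k(2) by blast
  ultimately show ?case
    using Suc(3) k by (subst mric.simps) auto
qed

lemma phi_carrier [simp]: "k < horizon G \<Longrightarrow> phi G k \<in> carrier_vec (sdim G)"
  by (rule phi_carrier_if) auto

lemma xstar_carrier [simp]: "k \<le> horizon G \<Longrightarrow> xstar G x0 k \<in> carrier_vec (sdim G)"
  by (induction k) auto

lemma feedback_costate_carrier [simp]:
  "k \<in> stages G \<Longrightarrow> i \<in> players G \<Longrightarrow> y \<in> carrier_vec (sdim G) \<Longrightarrow>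
    feedback_costate G i k y \<in> carrier_vec (sdim G)"
  unfolding feedback_costate_def by (auto simp: stages_def)

lemma feedback_control_carrier [simp]:
  "k \<in> stages G \<Longrightarrow> i \<in> players G \<Longrightarrow> y \<in> carrier_vec (sdim G) \<Longrightarrow>
    feedback_control G i k y \<in> carrier_vec (cdim G i)"
  unfolding feedback_control_def by auto

text \<open>The feedback control at stage \<open>k + 1\<close> depends on the state \<open>y\<close> reached at that stage; solving
  the implicit equation for \<open>y\<close> is what the invertibility of the coupling matrix is for.\<close>

lemma closed_loop_iff:
  assumes k: "k < horizon G" and x: "x \<in> carrier_vec (sdim G)" and y: "y \<in> carrier_vec (sdim G)"
  shows "y = Amat G (Suc k) *\<^sub>v x
      + finsum_vec TYPE(real) (sdim G) (\<lambda>j. Bmat G (Suc k) j *\<^sub>v feedback_control G j (Suc k) y) (players G)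
      + svec G (Suc k)
    \<longleftrightarrow> y = Phi G k *\<^sub>v x + phi G k"
proof -
  have kS: "Suc k \<in> stages G" "Suc k \<le> horizon G" using k by auto
  note k [simp] kS(2) [simp]
  \<comment> \<open>\<open>X\<close> is the part of the reaction that is linear in y and is absorbed
    into the coupling matrix; \<open>C\<close> is free of y and reappears in
    \<open>phi\<close>.\<close>
  define X where "X j = Bmat G (Suc k) j *\<^sub>v (minv (Rmat G (Suc k) j j) *\<^sub>v
    (transpose_mat (Bmat G (Suc k) j) *\<^sub>v (Mric G (Suc k) j *\<^sub>v y)))" for j
  define C where "C j = Bmat G (Suc k) j *\<^sub>v (minv (Rmat G (Suc k) j j) *\<^sub>v
    (transpose_mat (Bmat G (Suc k) j) *\<^sub>v (mric G (Suc k) j - Qmat G (Suc k) j *\<^sub>v xtgt G (Suc k) j))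
    - utgt G (Suc k) j j)" for j
  have X: "X j \<in> carrier_vec (sdim G)" and C: "C j \<in> carrier_vec (sdim G)" if "j \<in> players G" for j
    unfolding X_def C_def using that y by auto
  have ctrl: "Bmat G (Suc k) j *\<^sub>v feedback_control G j (Suc k) y = - X j - C j" if j: "j \<in> players G" for j
  proof -
    let ?B = "Bmat G (Suc k) j" and ?R = "minv (Rmat G (Suc k) j j)" and ?u = "utgt G (Suc k) j j"
    define a where "a = Mric G (Suc k) j *\<^sub>v y"
    define b where "b = mric G (Suc k) j - Qmat G (Suc k) j *\<^sub>v xtgt G (Suc k) j"
    have a: "a \<in> carrier_vec (sdim G)" and b: "b \<in> carrier_vec (sdim G)"
      unfolding a_def b_def using j y by auto
    have BT: "transpose_mat ?B \<in> carrier_mat (cdim G j) (sdim G)"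
      using B_carrier[OF kS(1) j] by simp
    have ab: "feedback_costate G j (Suc k) y = a + b"
      unfolding feedback_costate_def a_def b_def
      using j y kS by (intro add_diff_assoc_vec[of _ "sdim G"]) auto
    define a' where "a' = ?R *\<^sub>v (transpose_mat ?B *\<^sub>v a)"
    define b' where "b' = ?R *\<^sub>v (transpose_mat ?B *\<^sub>v b)"
    have a': "a' \<in> carrier_vec (cdim G j)" and b': "b' \<in> carrier_vec (cdim G j)"
      unfolding a'_def b'_def using j a b by auto
    have "?R *\<^sub>v (transpose_mat ?B *\<^sub>v (a + b)) = a' + b'"
      unfolding a'_def b'_def
      using mult_add_distrib_mat_vec[OF BT a b]
        mult_add_distrib_mat_vec[OF Rinv_carrier[OF kS(1) j] BT_mult[OF kS(1) j a] BT_mult[OF kS(1) j b]]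
      by simp
    then have "?B *\<^sub>v feedback_control G j (Suc k) y = ?B *\<^sub>v (?u - (a' + b'))"
      unfolding feedback_control_def ab by simp
    also have "\<dots> = - (?B *\<^sub>v a') - ?B *\<^sub>v (b' - ?u)"
      using j a' b' B_mult[OF kS(1) j a'] B_mult[OF kS(1) j b'] B_mult[OF kS(1) j utgt_carrier[OF kS(1) j j]]
      by (simp add: mult_minus_distrib_mat_vec[OF B_carrier[OF kS(1) j]]
          mult_add_distrib_mat_vec[OF B_carrier[OF kS(1) j]])
        (intro eq_vecI; simp del: index_mult_mat_vec add: carrier_vecD)
    finally show ?thesis
      unfolding X_def C_def a'_def b'_def a_def b_def .
  qed
  define FX where "FX = finsum_vec TYPE(real) (sdim G) X (players G)"
  define FC where "FC = finsum_vec TYPE(real) (sdim G) C (players G)"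
  have FX: "FX \<in> carrier_vec (sdim G)" and FC: "FC \<in> carrier_vec (sdim G)"
    unfolding FX_def FC_def using X C by (auto intro!: finsum_vec_closed)
  have "finsum_vec TYPE(real) (sdim G) (\<lambda>j. Bmat G (Suc k) j *\<^sub>v feedback_control G j (Suc k) y) (players G)
      = finsum_vec TYPE(real) (sdim G) (\<lambda>j. - X j - C j) (players G)"
    using X C by (intro finsum_vec_cong ctrl) auto
  also have "\<dots> = - FX - FC"
    unfolding FX_def FC_def using X C by (intro finsum_vec_diff) auto
  finally have sum: "finsum_vec TYPE(real) (sdim G)
      (\<lambda>j. Bmat G (Suc k) j *\<^sub>v feedback_control G j (Suc k) y) (players G) = - FX - FC" .
  define K where "K = coupling G (Suc k) (\<lambda>j. Mric G (Suc k) j)"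
  have K: "K \<in> carrier_mat (sdim G) (sdim G)" "minv K \<in> carrier_mat (sdim G) (sdim G)" "invertible_mat K"
    unfolding K_def using coupling_Mric[OF k] coupling_invertible by auto
  have Ky: "K *\<^sub>v y = y + FX"
    unfolding K_def FX_def X_def by (intro coupling_mult_vec) (use y in auto)
  have Ax: "Amat G (Suc k) *\<^sub>v x \<in> carrier_vec (sdim G)" using x by simp
  have sFC: "svec G (Suc k) - FC \<in> carrier_vec (sdim G)" using FC by simp
  have "Phi G k = minv K * Amat G (Suc k)" "phi G k = minv K *\<^sub>v (svec G (Suc k) - FC)"
    unfolding K_def FC_def C_def using k by (subst Phi.simps phi.simps; simp)+
  then have "Phi G k *\<^sub>v x + phi G k = minv K *\<^sub>v (Amat G (Suc k) *\<^sub>v x + (svec G (Suc k) - FC))"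
    using mult_add_distrib_mat_vec[OF K(2) Ax sFC] assoc_mult_mat_vec[OF K(2) A_carrier[OF kS(1)] x] by simp
  then have "y = Phi G k *\<^sub>v x + phi G k \<longleftrightarrow> K *\<^sub>v y = Amat G (Suc k) *\<^sub>v x + (svec G (Suc k) - FC)"
    using minv_solve[OF K(1,3) y] Ax sFC by simp
  also have "\<dots> \<longleftrightarrow> y = Amat G (Suc k) *\<^sub>v x + (- FX - FC) + svec G (Suc k)"
    unfolding Ky
  proof -
    have "v + f = a + (s - c) \<longleftrightarrow> v = a + (- f - c) + s"
      if "v \<in> carrier_vec n" "f \<in> carrier_vec n" "a \<in> carrier_vec n" "s \<in> carrier_vec n" "c \<in> carrier_vec n"
      for v f a s c :: "real vec" and n
      using that by (auto simp: vec_eq_iff algebra_simps)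
    from this[OF y FX Ax s_carrier[OF kS(1)] FC]
    show "y + FX = Amat G (Suc k) *\<^sub>v x + (svec G (Suc k) - FC)
      \<longleftrightarrow> y = Amat G (Suc k) *\<^sub>v x + (- FX - FC) + svec G (Suc k)" .
  qed
  finally show ?thesis
    unfolding sum by blast
qed

section \<open>Costates and controls in Riccati form\<close>

text \<open>One backward step. Substituting the closed-loop step into the costate formula at k+1
  splits the adjoint term into a part linear in x_k and a constant, which are the increments in the
  recursions of \<open>Mric\<close> and \<open>mric\<close>. The facts about stage k+1 are premises
  guarded by k being below the horizon, so the lemma also starts the induction and serves both
  uniqueness and existence.\<close>

lemma costate_eq_feedback:
  assumes i: "i \<in> players G" and x: "\<And>k. k \<le> horizon G \<Longrightarrow> x k \<in> carrier_vec (sdim G)"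
    and k: "k \<in> stages G"
    and tail: "k < horizon G \<Longrightarrow> x (Suc k) = Phi G k *\<^sub>v x k + phi G k"
      "k < horizon G \<Longrightarrow> costate G i x (Suc k) = feedback_costate G i (Suc k) (x (Suc k))"
  shows "costate G i x k = feedback_costate G i k (x k)"
proof (cases "k < horizon G")
  case False
  \<comment> \<open>Positivity of k turns \<open>Qext\<close> into \<open>Qmat\<close>; the
    convention for stage 0 would give the zero matrix.\<close>
  then have kT: "k = horizon G" "k > 0" using k by (auto simp: stages_def)
  have xk: "x k \<in> carrier_vec (sdim G)" using x kT by simp
  have "costate G i x k = Qmat G k i *\<^sub>v x k - Qmat G k i *\<^sub>v xtgt G k i"
    using False k i xk mult_minus_distrib_mat_vec[OF Q_carrier[OF k i] xk xtgt_carrier[OF k i]]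
    by (subst costate.simps) simp
  moreover have "Mric G k i = Qmat G k i" "mric G k i = 0\<^sub>v (sdim G)"
    using kT by (subst Mric.simps mric.simps; simp add: Qext_def)+
  ultimately show ?thesis
    unfolding feedback_costate_def using Q_mult[OF k i xk] by simp
next
  case True
  let ?A = "transpose_mat (Amat G (Suc k))" and ?M = "Mric G (Suc k) i"
  have k0: "k > 0" using k by (auto simp: stages_def)
  have kS: "Suc k \<in> stages G" "Suc k \<le> horizon G" using True by auto
  note True [simp] kS(2) [simp]
  have xk [simp]: "x k \<in> carrier_vec (sdim G)" by (rule x) (use kS(2) in linarith)
  have A: "?A \<in> carrier_mat (sdim G) (sdim G)" using A_carrier[OF kS(1)] by simp
  have M: "?M \<in> carrier_mat (sdim G) (sdim G)" using i by simp
  define a where "a = ?M *\<^sub>v (Phi G k *\<^sub>v x k)"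
  define b where "b = ?M *\<^sub>v phi G k + mric G (Suc k) i - Qmat G (Suc k) i *\<^sub>v xtgt G (Suc k) i"
  have a: "a \<in> carrier_vec (sdim G)" and b: "b \<in> carrier_vec (sdim G)"
    unfolding a_def b_def using i True by auto
  have "feedback_costate G i (Suc k) (x (Suc k)) = a + b"
    unfolding feedback_costate_def tail(1)[OF True] a_def b_def
      mult_add_distrib_mat_vec[OF M Phi_mult[OF True xk] phi_carrier[OF True]]
    using i by (simp add: add_diff_assoc_vec[of _ "sdim G"] assoc_add_vec[of _ "sdim G"])
  then have "?A *\<^sub>v costate G i x (Suc k) = ?A *\<^sub>v a + ?A *\<^sub>v b"
    using tail(2)[OF True] mult_add_distrib_mat_vec[OF A a b] by simp
  then have "costate G i x k = Qmat G k i *\<^sub>v (x k - xtgt G k i) + (?A *\<^sub>v a + ?A *\<^sub>v b)"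
    using True by (subst costate.simps) simp
  moreover have "Mric G k i *\<^sub>v x k = Qmat G k i *\<^sub>v x k + ?A *\<^sub>v a"
  proof -
    have AM: "?A * ?M \<in> carrier_mat (sdim G) (sdim G)" using mult_carrier_mat[OF A M] .
    have "?A * ?M * Phi G k *\<^sub>v x k = ?A *\<^sub>v a"
      unfolding a_def
      using assoc_mult_mat_vec[OF AM Phi_carrier[OF True] xk]
        assoc_mult_mat_vec[OF A M Phi_mult[OF True xk]] by simp
    moreover have "Mric G k i = Qmat G k i + ?A * ?M * Phi G k"
      using True k0 by (subst Mric.simps) (simp add: Qext_def)
    moreover have "?A * ?M * Phi G k \<in> carrier_mat (sdim G) (sdim G)"
      using AM Phi_carrier[OF True] by simp
    ultimately show ?thesis
      using add_mult_distrib_mat_vec[OF Q_carrier[OF k i] _ xk] by simp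
  qed
  moreover have "mric G k i = ?A *\<^sub>v b"
    using True unfolding b_def by (subst mric.simps) simp
  moreover have "Qmat G k i *\<^sub>v (x k - xtgt G k i) = Qmat G k i *\<^sub>v x k - Qmat G k i *\<^sub>v xtgt G k i"
    using mult_minus_distrib_mat_vec[OF Q_carrier[OF k i] xk] k i by simp
  moreover have "p - q + (r + s) = p + r + s - q" if "p \<in> carrier_vec n" "q \<in> carrier_vec n"
    "r \<in> carrier_vec n" "s \<in> carrier_vec n" for p q r s :: "real vec" and n
    using that by (intro eq_vecI) auto
  ultimately show ?thesis
    unfolding feedback_costate_def
    using Q_mult[OF k i xk] Q_mult[OF k i xtgt_carrier[OF k i]] A_mult(2)[OF kS(1) a] A_mult(2)[OF kS(1) b]
    by simp
qed

text \<open>Solvable for the control because a positive definite R_k^{ii} is invertible. Uniqueness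
  reads the control off stationarity; existence uses the converse.\<close>

lemma gradient_zero_iff:
  assumes u: "u \<in> profiles G" and i: "i \<in> players G" and k: "k \<in> stages G"
  shows "gradient G x0 u i k = 0\<^sub>v (cdim G i) \<longleftrightarrow>
    u i k = utgt G k i i - minv (Rmat G k i i) *\<^sub>v (transpose_mat (Bmat G k i) *\<^sub>v costate G i (state G x0 u) k)"
proof -
  define b where "b = transpose_mat (Bmat G k i) *\<^sub>v costate G i (state G x0 u) k"
  define w where "w = u i k - utgt G k i i"
  have b: "b \<in> carrier_vec (cdim G i)" and w: "w \<in> carrier_vec (cdim G i)"
    and ui: "u i k \<in> carrier_vec (cdim G i)" and ut: "utgt G k i i \<in> carrier_vec (cdim G i)"
    and Rb: "minv (Rmat G k i i) *\<^sub>v b \<in> carrier_vec (cdim G i)"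
    and Rw: "Rmat G k i i *\<^sub>v w \<in> carrier_vec (cdim G i)"
    unfolding b_def w_def using u i k by auto
  have "gradient G x0 u i k = 0\<^sub>v (cdim G i) \<longleftrightarrow> Rmat G k i i *\<^sub>v w = - b"
    unfolding gradient_def b_def[symmetric] w_def[symmetric] using b Rw
    by (auto simp: vec_eq_iff add_eq_0_iff simp del: index_mult_mat_vec)
  also have "\<dots> \<longleftrightarrow> w = minv (Rmat G k i i) *\<^sub>v (- b)"
    using minv_solve[OF R_carrier[OF k i i] pos_def_invertible[OF R_carrier[OF k i i] R_pos_def[OF k i]] w] b
    by simp
  also have "minv (Rmat G k i i) *\<^sub>v (- b) = - (minv (Rmat G k i i) *\<^sub>v b)"
    using Rinv_carrier[OF k i] b by (intro eq_vecI) auto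
  also have "w = - (minv (Rmat G k i i) *\<^sub>v b) \<longleftrightarrow> u i k = utgt G k i i - minv (Rmat G k i i) *\<^sub>v b"
    unfolding w_def using ui ut Rb
    by (auto simp: vec_eq_iff algebra_simps simp del: index_mult_mat_vec)
  finally show ?thesis
    unfolding b_def .
qed

text \<open>Passes from the implicit feedback on the state reached at stage k+1 to the explicit one
  on the preceding state x.\<close>

lemma feedback_control_eq:
  assumes k: "k < horizon G" and i: "i \<in> players G" and x: "x \<in> carrier_vec (sdim G)"
  shows "feedback_control G i (Suc k) (Phi G k *\<^sub>v x + phi G k)
    = - Pgain G (Suc k) i *\<^sub>v x - alph G (Suc k) i"
proof -
  let ?B = "transpose_mat (Bmat G (Suc k) i)" and ?R = "minv (Rmat G (Suc k) i i)" and ?M = "Mric G (Suc k) i"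
  have kS: "Suc k \<in> stages G" "Suc k \<le> horizon G" using k by auto
  note k [simp] kS(2) [simp]
  have B: "?B \<in> carrier_mat (cdim G i) (sdim G)" using B_carrier[OF kS(1) i] by simp
  have R: "?R \<in> carrier_mat (cdim G i) (cdim G i)" using i by simp
  have M: "?M \<in> carrier_mat (sdim G) (sdim G)" using i by simp
  have RB: "?R * ?B \<in> carrier_mat (cdim G i) (sdim G)" using R B by simp
  have RBM: "?R * ?B * ?M \<in> carrier_mat (cdim G i) (sdim G)" using RB M by simp
  define a where "a = ?M *\<^sub>v (Phi G k *\<^sub>v x)"
  define b where "b = ?M *\<^sub>v phi G k + mric G (Suc k) i - Qmat G (Suc k) i *\<^sub>v xtgt G (Suc k) i"
  have a: "a \<in> carrier_vec (sdim G)" and b: "b \<in> carrier_vec (sdim G)"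
    unfolding a_def b_def using i k x by auto
  have RBa: "?R *\<^sub>v (?B *\<^sub>v a) \<in> carrier_vec (cdim G i)" and RBb: "?R *\<^sub>v (?B *\<^sub>v b) \<in> carrier_vec (cdim G i)"
    using i a b by auto
  have "feedback_costate G i (Suc k) (Phi G k *\<^sub>v x + phi G k) = a + b"
    unfolding feedback_costate_def a_def b_def
      mult_add_distrib_mat_vec[OF M Phi_mult[OF k x] phi_carrier[OF k]]
    using i x by (simp add: add_diff_assoc_vec[of _ "sdim G"] assoc_add_vec[of _ "sdim G"])
  then have "feedback_control G i (Suc k) (Phi G k *\<^sub>v x + phi G k)
      = utgt G (Suc k) i i - (?R *\<^sub>v (?B *\<^sub>v a) + ?R *\<^sub>v (?B *\<^sub>v b))"
    unfolding feedback_control_def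
    using mult_add_distrib_mat_vec[OF B a b]
      mult_add_distrib_mat_vec[OF R BT_mult[OF kS(1) i a] BT_mult[OF kS(1) i b]] by simp
  also have "\<dots> = - (?R *\<^sub>v (?B *\<^sub>v a)) - (?R *\<^sub>v (?B *\<^sub>v b) - utgt G (Suc k) i i)"
  proof -
    have "u - (v + w) = - v - (w - u)"
      if "u \<in> carrier_vec n" "v \<in> carrier_vec n" "w \<in> carrier_vec n" for u v w :: "real vec" and n
      using that by (intro eq_vecI) auto
    from this[OF utgt_carrier[OF kS(1) i i] RBa RBb] show ?thesis .
  qed
  also have "?R *\<^sub>v (?B *\<^sub>v b) - utgt G (Suc k) i i = alph G (Suc k) i"
    unfolding alph_def b_def[symmetric] using assoc_mult_mat_vec[OF R B b] by (simp add: b_def)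
  also have "- (?R *\<^sub>v (?B *\<^sub>v a)) = - Pgain G (Suc k) i *\<^sub>v x"
  proof -
    have "Pgain G (Suc k) i \<in> carrier_mat (cdim G i) (sdim G)"
      unfolding Pgain_def using RBM Phi_carrier[OF k] by simp
    moreover have "Pgain G (Suc k) i *\<^sub>v x = ?R *\<^sub>v (?B *\<^sub>v a)"
      unfolding Pgain_def a_def
      using assoc_mult_mat_vec[OF RBM Phi_carrier[OF k] x] assoc_mult_mat_vec[OF RB M Phi_mult[OF k x]]
        assoc_mult_mat_vec[OF R B Mric_mult[OF i kS(2) Phi_mult[OF k x]]] by simp
    ultimately show ?thesis
      using x uminus_mult_mat_vec[of x "Pgain G (Suc k) i"] by simp
  qed
  finally show ?thesis .
qed

section \<open>Uniqueness and existence of the equilibrium\<close>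

text \<open>The claims must go through the backward induction together. The costate at k+1 needs the
  state step and the costate after it; stationarity then gives all controls at k+1; these controls
  turn the dynamics into the implicit equation that yields the state step from k.\<close>

lemma nash_closed_loop:
  assumes nash: "open_loop_nash G x0 u" and k: "k < horizon G"
  shows "state G x0 u (Suc k) = Phi G k *\<^sub>v state G x0 u k + phi G k
    \<and> (\<forall>i\<in>players G. u i (Suc k) = feedback_control G i (Suc k) (state G x0 u (Suc k))
        \<and> costate G i (state G x0 u) (Suc k) = feedback_costate G i (Suc k) (state G x0 u (Suc k)))"
  using k
proof (induction "horizon G - k" arbitrary: k rule: less_induct)
  case less
  let ?x = "state G x0 u"
  have u: "u \<in> profiles G" using nash by (simp add: open_loop_nash_def)
  have k: "Suc k \<in> stages G" using less by simp
  have p: "costate G i ?x (Suc k) = feedback_costate G i (Suc k) (?x (Suc k))" if i: "i \<in> players G" for i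
  proof (rule costate_eq_feedback[OF i _ k])
    assume "Suc k < horizon G"
    with less(1)[of "Suc k"] i
    show "?x (Suc (Suc k)) = Phi G (Suc k) *\<^sub>v ?x (Suc k) + phi G (Suc k)"
      and "costate G i ?x (Suc (Suc k)) = feedback_costate G i (Suc (Suc k)) (?x (Suc (Suc k)))"
      by (auto simp del: state.simps)
  qed (use u in simp)
  have ctrl: "u i (Suc k) = feedback_control G i (Suc k) (?x (Suc k))" if i: "i \<in> players G" for i
    using nash_imp_gradient_zero[OF nash i k] gradient_zero_iff[OF u i k] p[OF i]
    by (simp add: feedback_control_def del: state.simps)
  have carrier: "?x k \<in> carrier_vec (sdim G)" "?x (Suc k) \<in> carrier_vec (sdim G)"
    using u less(2) by (auto simp del: state.simps)
  have "finsum_vec TYPE(real) (sdim G) (\<lambda>j. Bmat G (Suc k) j *\<^sub>v u j (Suc k)) (players G)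
      = finsum_vec TYPE(real) (sdim G)
          (\<lambda>j. Bmat G (Suc k) j *\<^sub>v feedback_control G j (Suc k) (?x (Suc k))) (players G)"
    using k carrier(2) by (intro finsum_vec_cong) (auto simp: ctrl simp del: state.simps)
  then have "?x (Suc k) = Phi G k *\<^sub>v ?x k + phi G k"
    using closed_loop_iff[OF less(2) carrier] state.simps(2)[of G x0 u k] by simp
  then show ?case
    using p ctrl by blast
qed

lemma nash_state:
  assumes "open_loop_nash G x0 u" "k \<le> horizon G"
  shows "state G x0 u k = xstar G x0 k"
  using assms(2)
proof (induction k)
  case (Suc k)
  then show ?case
    using nash_closed_loop[OF assms(1), of k] by (simp del: state.simps)
qed simp

lemma nash_control:
  assumes "open_loop_nash G x0 u" "k < horizon G" "i \<in> players G"
  shows "u i (Suc k) = - Pgain G (Suc k) i *\<^sub>v xstar G x0 k - alph G (Suc k) i"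
  using nash_closed_loop[OF assms(1,2)] nash_state[OF assms(1), of k] nash_state[OF assms(1), of "Suc k"]
    feedback_control_eq[OF assms(2,3), of "xstar G x0 k"] assms(2,3)
  by (simp del: state.simps)

lemma nash_unique:
  assumes "open_loop_nash G x0 u" "open_loop_nash G x0 v"
  shows "u = v"
proof -
  have u: "u \<in> profiles G" and v: "v \<in> profiles G"
    using assms by (auto simp: open_loop_nash_def)
  have "u i = v i" if i: "i \<in> players G" for i
  proof -
    have "u i \<in> strategies G i" "v i \<in> strategies G i"
      using u v i unfolding profiles_def by (auto dest: PiE_mem)
    moreover have "u i k = v i k" if "k \<in> stages G" for k
      using stages_cases[OF that] nash_control assms i by metis
    ultimately show ?thesis
      unfolding strategies_def by (blast intro: PiE_ext)
  qed
  with u v show ?thesis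
    unfolding profiles_def by (blast intro: PiE_ext)
qed

text \<open>The feedback is evaluated at \<open>xstar\<close>, not at the state that the profile
  generates, since it would otherwise refer to the state it helps to produce. That both trajectories
  agree is the converse direction of \<open>closed_loop_iff\<close>; stationarity follows from the
  costate formula.\<close>

lemma nash_exists: "\<exists>u. open_loop_nash G x0 u"
proof -
  define u where
    "u = (\<lambda>i\<in>players G. \<lambda>k\<in>stages G. feedback_control G i k (xstar G x0 k))"
  have xs: "xstar G x0 k \<in> carrier_vec (sdim G)" if "k \<in> stages G" for k
    using that by (auto simp: stages_def)
  have u: "u \<in> profiles G"
    unfolding u_def profiles_def strategies_def using xs by (auto intro!: restrict_PiE)
  have state: "state G x0 u k = xstar G x0 k" if "k \<le> horizon G" for k
    using that
  proof (induction k)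
    case (Suc k)
    have k: "Suc k \<in> stages G" "k < horizon G" using Suc by auto
    have "finsum_vec TYPE(real) (sdim G) (\<lambda>j. Bmat G (Suc k) j *\<^sub>v u j (Suc k)) (players G)
      = finsum_vec TYPE(real) (sdim G)
          (\<lambda>j. Bmat G (Suc k) j *\<^sub>v feedback_control G j (Suc k) (xstar G x0 (Suc k))) (players G)"
      using k xs[OF k(1)] by (intro finsum_vec_cong) (auto simp: u_def simp del: xstar.simps)
    then have "xstar G x0 (Suc k) = state G x0 u (Suc k)"
      using closed_loop_iff[OF k(2), of "xstar G x0 k" "xstar G x0 (Suc k)"] Suc
        xs[OF k(1)] xstar_carrier[of k] xstar.simps(2)[of G x0 k] by (simp del: xstar.simps)
    then show ?case by simp
  qed simp
  have p: "costate G i (state G x0 u) k = feedback_costate G i k (state G x0 u k)"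
    if "i \<in> players G" "k \<in> stages G" for i k
    using that(2)
  proof (induction "horizon G - k" arbitrary: k rule: less_induct)
    case less
    have carrier: "state G x0 u k \<in> carrier_vec (sdim G)" if "k \<le> horizon G" for k
      using u that by (rule state_carrier)
    show ?case
      using that(1) carrier less(2)
    proof (rule costate_eq_feedback)
      assume k: "k < horizon G"
      then show "costate G i (state G x0 u) (Suc k) = feedback_costate G i (Suc k) (state G x0 u (Suc k))"
        using less(1)[of "Suc k"] by simp
      show "state G x0 u (Suc k) = Phi G k *\<^sub>v state G x0 u k + phi G k"
        using k state[of k] state[of "Suc k"] by (simp del: state.simps)
    qed
  qed
  have "gradient G x0 u i k = 0\<^sub>v (cdim G i)" if i: "i \<in> players G" and k: "k \<in> stages G" for i k
    unfolding gradient_zero_iff[OF u i k] p[OF i k]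
    using i k state[of k] by (simp add: u_def feedback_control_def stages_def)
  then show ?thesis
    using gradient_zero_imp_nash[OF u] by blast
qed

end

theorem theorem7:
  fixes G :: aq_game and x0 :: "real vec"
  assumes "wf_game G"
    and "x0 \<in> carrier_vec (sdim G)"
    and "\<And>k i. k \<in> stages G \<Longrightarrow> i \<in> players G \<Longrightarrow> pos_semidef (Qmat G k i)"
    and "\<And>k i. k \<in> stages G \<Longrightarrow> i \<in> players G \<Longrightarrow> pos_def (Rmat G k i i)"
    and "\<And>k. k \<in> stages G \<Longrightarrow> invertible_mat (coupling G k (\<lambda>j. Mric G k j))"
  shows "(\<exists>!u. open_loop_nash G x0 u) \<and>
    (\<forall>u. open_loop_nash G x0 u \<longrightarrow>
       (\<forall>k \<le> horizon G. state G x0 u k = xstar G x0 k) \<and>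
       (\<forall>k < horizon G. \<forall>i\<in>players G.
          u i (k + 1) = - Pgain G (k + 1) i *\<^sub>v xstar G x0 k - alph G (k + 1) i))"
proof -
  interpret game G x0
    using assms by unfold_locales auto
  show ?thesis
    using nash_exists nash_unique nash_state nash_control by auto
qed

end
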